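(* Let $p>3$ be a prime and let $A,B\in\mathbb{Z}$ with $p\nmid A$. Then $$\sum_{k=1}^{p-1}\frac{v_k(A,B)H_k}{kA^k}\equiv 0 \pmod p$$ and $$\sum_{k=1}^{p-1}\frac{u_k(A,B)H_k}{kA^k}\equiv\frac 2p\sum_{k=1}^{p-1}\frac{u_k(A,B)}{kA^k} \pmod p.$$
   Context: For $n\in\{0,1,2,\ldots\}$, the harmonic number is $H_n=\sum_{0<j\le n}1/j$ (so $H_0=0$). For $A,B\in\mathbb{Z}$ the Lucas sequences $u_n=u_n(A,B)$ and $v_n=v_n(A,B)$ ($n\ge 0$) are defined by $u_0=0$, $u_1=1$, $u_{n+1}=Au_n-Bu_{n-1}$ for $n\ge1$, and $v_0=2$, $v_1=A$, $v_{n+1}=Av_n-Bv_{n-1}$ for $n\ge1$. A congruence $x\equiv y\pmod{p}$ between rational numbers means that $x-y\in p\,\mathbb{Z}_{(p)}$, where $\mathbb{Z}_{(p)}$ is the ring of rational numbers whose denominator (in lowest terms) is prime to $p$. *)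

theory Defs
  imports Complex_Main "HOL-Computational_Algebra.Primes"
begin

text \<open>The library's \<open>harm\<close> is restricted to real normed fields, which excludes \<^typ>\<open>rat\<close>.\<close>

definition harmonic :: "nat \<Rightarrow> rat" where
  "harmonic n = (\<Sum>j\<in>{0<..n}. 1 / of_nat j)"

fun lucas_u :: "int \<Rightarrow> int \<Rightarrow> nat \<Rightarrow> int" where
  "lucas_u A B 0 = 0"
| "lucas_u A B (Suc 0) = 1"
| "lucas_u A B (Suc (Suc n)) = A * lucas_u A B (Suc n) - B * lucas_u A B n"

fun lucas_v :: "int \<Rightarrow> int \<Rightarrow> nat \<Rightarrow> int" where
  "lucas_v A B 0 = 2"
| "lucas_v A B (Suc 0) = A"
| "lucas_v A B (Suc (Suc n)) = A * lucas_v A B (Suc n) - B * lucas_v A B n"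

text \<open>\<^const>\<open>quotient_of\<close> yields numerator and positive denominator in lowest terms.\<close>

definition Z_loc :: "nat \<Rightarrow> rat set" where
  "Z_loc p = {x. coprime (snd (quotient_of x)) (int p)}"

text \<open>Neither \<open>x\<close> nor \<open>y\<close> is required to lie in \<^term>\<open>Z_loc p\<close>; only their difference matters.\<close>

definition rat_cong :: "rat \<Rightarrow> rat \<Rightarrow> nat \<Rightarrow> bool" where
  "rat_cong x y p \<longleftrightarrow> (\<exists>z\<in>Z_loc p. x - y = of_nat p * z)"

end

theory Submission
  imports Defs
begin

text \<open>
  Put \<open>v k = lucas_v A B k / A ^ k\<close> and \<open>u k = lucas_u A B k / A ^ k\<close>. If \<open>\<alpha>\<close> and \<open>\<beta>\<close> are the roots of
  \<open>X\<^sup>2 - A X + B\<close>, then \<open>v k = x ^ k + y ^ k\<close> with \<open>x = \<alpha> / A\<close> and \<open>y = \<beta> / A = 1 - x\<close>, and \<open>u k\<close> is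
  proportional to \<open>x ^ k - y ^ k\<close> unless \<open>x = y\<close>. The binomial transform
  \<open>w k \<mapsto> (\<Sum>j\<le>k. (k choose j) * (-1) ^ j * w j)\<close> sends \<open>x ^ k\<close> to \<open>(1 - x) ^ k\<close>, so it fixes \<open>v\<close> and
  negates \<open>u\<close>; the common recurrence of \<open>u\<close> and \<open>v\<close> gives this also for \<open>x = y\<close>
  (\<open>binomial_transform_eigen\<close>). Each congruence holds for every \<open>p\<close>-integral sequence \<open>w\<close> with the
  corresponding symmetry.

  Write \<open>G = (\<Sum>k. w k / k)\<close>, \<open>G2 = (\<Sum>k. w k / k\<^sup>2)\<close> and \<open>F = (\<Sum>k. w k * H k / k)\<close>, with \<open>k\<close> running
  over \<open>1..p - 1\<close> and \<open>H\<close> the harmonic numbers. Expanding the transform \<open>w'\<close> of \<open>w\<close> in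
  \<open>(\<Sum>k. w' k / k\<^sup>2)\<close> and evaluating the inner sums modulo \<open>p\<close> gives
  \<open>(\<Sum>k. w' k / k\<^sup>2) \<equiv> w 0 * (\<Sum>k. 1 / k\<^sup>2) + G2 - F \<equiv> G2 - F\<close>; if \<open>w' = e * w\<close>, this reads \<open>F \<equiv> (1 - e) * G2\<close>
  (\<open>harmonic_sum_of_eigensequence\<close>). For \<open>e = 1\<close>, the case of \<open>v\<close>, it is the first congruence.

  For \<open>e = -1\<close>, the case of \<open>u\<close>, it says \<open>F \<equiv> 2 * G2\<close>. The symmetry at index \<open>p\<close> itself says that
  \<open>(\<Sum>k. (p choose k) * (-1) ^ k * w k) = 0\<close>, and expanding \<open>p choose k\<close> to second order in \<open>p\<close>
  turns this into \<open>G / p \<equiv> F - G2\<close> (\<open>odd_eigensequence_mod_square\<close>). Together,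
  \<open>2 * G / p \<equiv> 2 * F - 2 * G2 \<equiv> F\<close>, the second congruence.
\<close>

section \<open>The ring of \<open>p\<close>-integral rationals\<close>

text \<open>
  Membership can be read off from any fraction representing \<open>x\<close>, reduced or not; this makes the
  ring operations easy, since sums and products of reduced fractions need not be reduced.
\<close>

lemma Z_loc_iff_fraction:
  "x \<in> Z_loc p \<longleftrightarrow> (\<exists>a b. b \<noteq> 0 \<and> coprime b (int p) \<and> x = of_int a / of_int b)"
proof
  assume "x \<in> Z_loc p"
  moreover have "x = of_int (fst (quotient_of x)) / of_int (snd (quotient_of x))"
    by (simp add: quotient_of_div)
  moreover have "snd (quotient_of x) \<noteq> 0"
    using quotient_of_denom_pos' [of x] by simp
  ultimately show "\<exists>a b. b \<noteq> 0 \<and> coprime b (int p) \<and> x = of_int a / of_int b"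
    unfolding Z_loc_def by blast
next
  assume "\<exists>a b. b \<noteq> 0 \<and> coprime b (int p) \<and> x = of_int a / of_int b"
  then obtain a b where b: "b \<noteq> 0" "coprime b (int p)" and x: "x = of_int a / of_int b"
    by blast
  obtain c d where q: "quotient_of x = (c, d)" by force
  have cd: "coprime c d" "d > 0" "x = of_int c / of_int d"
    using q by (auto simp: quotient_of_coprime quotient_of_denom_pos quotient_of_div)
  have "(of_int (c * b) :: rat) = of_int (a * d)"
    using x cd b by (simp add: field_simps)
  then have "c * b = a * d" by (simp only: of_int_eq_iff)
  then have "d dvd c * b" by simp
  then have "d dvd b" using cd by (simp add: coprime_dvd_mult_right_iff coprime_commute)
  then have "coprime d (int p)" using b coprime_divisors dvd_refl by blast
  then show "x \<in> Z_loc p" by (simp add: Z_loc_def q)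
qed

lemma Z_loc_of_int [simp]: "of_int a \<in> Z_loc p"
  unfolding Z_loc_iff_fraction by (rule exI[of _ a], rule exI[of _ 1]) simp

lemma Z_loc_of_nat [simp]: "of_nat n \<in> Z_loc p"
  using Z_loc_of_int [of "int n" p] by simp

lemma Z_loc_0 [simp]: "0 \<in> Z_loc p" and Z_loc_1 [simp]: "1 \<in> Z_loc p"
  using Z_loc_of_int [of 0 p] Z_loc_of_int [of 1 p] by simp_all

lemma Z_loc_add:
  assumes "x \<in> Z_loc p" "y \<in> Z_loc p" shows "x + y \<in> Z_loc p"
proof -
  obtain a b c d where "b \<noteq> 0" "coprime b (int p)" "x = of_int a / of_int b"
    and "d \<noteq> 0" "coprime d (int p)" "y = of_int c / of_int d"
    using assms unfolding Z_loc_iff_fraction by blast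
  then have "b * d \<noteq> 0" "coprime (b * d) (int p)"
    "x + y = of_int (a * d + c * b) / of_int (b * d)"
    by (auto simp: add_frac_eq)
  then show ?thesis unfolding Z_loc_iff_fraction by blast
qed

lemma Z_loc_mult:
  assumes "x \<in> Z_loc p" "y \<in> Z_loc p" shows "x * y \<in> Z_loc p"
proof -
  obtain a b c d where "b \<noteq> 0" "coprime b (int p)" "x = of_int a / of_int b"
    and "d \<noteq> 0" "coprime d (int p)" "y = of_int c / of_int d"
    using assms unfolding Z_loc_iff_fraction by blast
  then have "b * d \<noteq> 0" "coprime (b * d) (int p)"
    "x * y = of_int (a * c) / of_int (b * d)"
    by auto
  then show ?thesis unfolding Z_loc_iff_fraction by blast
qed

lemma Z_loc_uminus: "x \<in> Z_loc p \<Longrightarrow> - x \<in> Z_loc p"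
  using Z_loc_mult [of "of_int (-1)" p x] Z_loc_of_int [of "-1" p] by simp

lemma Z_loc_diff: "x \<in> Z_loc p \<Longrightarrow> y \<in> Z_loc p \<Longrightarrow> x - y \<in> Z_loc p"
  using Z_loc_add [of x p "- y"] Z_loc_uminus by simp

lemma Z_loc_power: "x \<in> Z_loc p \<Longrightarrow> x ^ n \<in> Z_loc p"
  by (induction n) (auto intro: Z_loc_mult)

lemma Z_loc_sum: "(\<And>i. i \<in> I \<Longrightarrow> f i \<in> Z_loc p) \<Longrightarrow> sum f I \<in> Z_loc p"
  by (induction I rule: infinite_finite_induct) (auto intro: Z_loc_add)

lemma Z_loc_inverse_of_int:
  assumes "prime p" "\<not> int p dvd a" shows "1 / of_int a \<in> Z_loc p"
proof -
  have "coprime (int p) a"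
    using assms by (intro prime_imp_coprime) auto
  moreover have "a \<noteq> 0" using assms by auto
  ultimately show ?thesis
    unfolding Z_loc_iff_fraction
    by (intro exI[of _ 1] exI[of _ a]) (simp add: coprime_commute)
qed

lemma Z_loc_inverse_of_nat:
  assumes "prime p" "0 < k" "k < p" shows "1 / of_nat k \<in> Z_loc p"
  using Z_loc_inverse_of_int [of p "int k"] assms by (simp add: nat_dvd_not_less)

lemma Z_loc_divide_of_nat:
  assumes "prime p" "0 < k" "k < p" "x \<in> Z_loc p" shows "x / of_nat k \<in> Z_loc p"
  using Z_loc_mult [OF assms(4) Z_loc_inverse_of_nat [OF assms(1-3)]] by simp

lemma Z_loc_harmonic:
  assumes "prime p" "n < p" shows "harmonic n \<in> Z_loc p"
  unfolding harmonic_def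
  by (intro Z_loc_sum Z_loc_inverse_of_nat) (use assms in auto)

lemmas Z_loc_closed = Z_loc_add Z_loc_diff Z_loc_mult Z_loc_uminus Z_loc_power Z_loc_sum
  Z_loc_divide_of_nat Z_loc_harmonic

lemma rat_congI: "x - y = of_nat p * z \<Longrightarrow> z \<in> Z_loc p \<Longrightarrow> rat_cong x y p"
  unfolding rat_cong_def by blast

lemma rat_congE:
  assumes "rat_cong x y p" obtains z where "z \<in> Z_loc p" "x = y + of_nat p * z"
  using assms unfolding rat_cong_def by (metis add.commute diff_add_cancel)

lemma rat_cong_refl: "rat_cong x x p"
  by (rule rat_congI[of _ _ _ 0]) simp_all

lemma rat_cong_add:
  assumes "rat_cong x y p" "rat_cong x' y' p" shows "rat_cong (x + x') (y + y') p"
proof -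
  obtain z z' where "z \<in> Z_loc p" "x = y + of_nat p * z" "z' \<in> Z_loc p" "x' = y' + of_nat p * z'"
    using assms by (metis rat_congE)
  then show ?thesis by (intro rat_congI[of _ _ _ "z + z'"]) (auto simp: algebra_simps Z_loc_add)
qed

lemma rat_cong_scale:
  assumes "c \<in> Z_loc p" "rat_cong x y p" shows "rat_cong (c * x) (c * y) p"
proof -
  obtain z where "z \<in> Z_loc p" "x = y + of_nat p * z"
    using assms by (metis rat_congE)
  then show ?thesis
    using assms by (intro rat_congI[of _ _ _ "c * z"]) (auto simp: algebra_simps Z_loc_mult)
qed

lemma rat_cong_sym: "rat_cong x y p \<Longrightarrow> rat_cong y x p"
  by (erule rat_congE) (rule rat_congI[where z = "- _"], auto intro: Z_loc_uminus)

lemma rat_cong_diff: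
  assumes "rat_cong x y p" "rat_cong x' y' p" shows "rat_cong (x - x') (y - y') p"
proof -
  have "rat_cong (- x') (- y') p"
    using rat_cong_scale [of "of_int (-1)"] assms(2) Z_loc_of_int [of "-1"] by fastforce
  with rat_cong_add [OF assms(1)] show ?thesis by fastforce
qed

lemma rat_cong_trans:
  assumes "rat_cong x y p" "rat_cong y z p" shows "rat_cong x z p"
  using rat_cong_add [OF assms] rat_cong_diff rat_cong_refl
  by (metis add.commute add_diff_cancel_right')

lemma rat_cong_sum:
  "(\<And>i. i \<in> I \<Longrightarrow> rat_cong (f i) (g i) p) \<Longrightarrow> rat_cong (sum f I) (sum g I) p"
  by (induction I rule: infinite_finite_induct) (auto intro: rat_cong_add rat_cong_refl)

section \<open>Harmonic numbers and binomial coefficients modulo a prime\<close>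

lemma harmonic_0 [simp]: "harmonic 0 = 0"
  by (simp add: harmonic_def)

lemma harmonic_Suc: "harmonic (Suc n) = harmonic n + 1 / of_nat (Suc n)"
proof -
  have "{0<..Suc n} = insert (Suc n) {0<..n}" by auto
  then show ?thesis by (simp add: harmonic_def add.commute)
qed

lemma harmonic_eq_sum: "harmonic n = (\<Sum>k = 1..n. 1 / of_nat k)"
  unfolding harmonic_def by (rule sum.cong) auto

text \<open>
  Pairing \<open>k\<close> with \<open>p - k\<close> produces \<open>1 / k + 1 / (p - k) = p / (k * (p - k))\<close>.
\<close>

lemma harmonic_prime_minus_1:
  assumes "prime p" "p > 2" shows "rat_cong (harmonic (p - 1)) 0 p"
proof -
  let ?z = "\<Sum>k = 1..p - 1. 1 / of_nat k / of_nat (p - k) / of_nat 2 :: rat"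
  have "harmonic (p - 1) = (\<Sum>k = 1..p - 1. 1 / of_nat (p - k))"
    unfolding harmonic_eq_sum
    by (rule sum.reindex_bij_witness[of _ "\<lambda>k. p - k" "\<lambda>k. p - k"]) auto
  then have "2 * harmonic (p - 1) = (\<Sum>k = 1..p - 1. 1 / of_nat k + 1 / of_nat (p - k))"
    by (simp add: sum.distrib harmonic_eq_sum)
  also have "\<dots> = (\<Sum>k = 1..p - 1. of_nat p * (1 / of_nat k / of_nat (p - k)))"
    by (rule sum.cong) (auto simp: of_nat_diff field_simps)
  also have "\<dots> = 2 * (of_nat p * ?z)"
    unfolding sum_distrib_left by (rule sum.cong) simp_all
  finally have "harmonic (p - 1) - 0 = of_nat p * ?z" by simp
  moreover have "?z \<in> Z_loc p"
    using assms by (intro Z_loc_closed Z_loc_1) auto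
  ultimately show ?thesis by (rule rat_congI)
qed

text \<open>
  The left side is the product of \<open>1 - p / i\<close> over \<open>1 \<le> i \<le> j\<close>, here expanded to first order in \<open>p\<close>.
\<close>

lemma binomial_prime_minus_1_mod_square:
  assumes "prime p" "j < p"
  shows "\<exists>z\<in>Z_loc p. (-1) ^ j * of_nat (p - 1 choose j)
           = 1 - of_nat p * harmonic j + (of_nat p)\<^sup>2 * (z :: rat)"
  using \<open>j < p\<close>
proof (induction j)
  case 0
  show ?case by (rule bexI[of _ 0]) simp_all
next
  case (Suc j)
  then obtain z where z: "z \<in> Z_loc p"
    "(-1) ^ j * of_nat (p - 1 choose j) = 1 - of_nat p * harmonic j + (of_nat p)\<^sup>2 * z"
    by auto
  have "Suc j * (p - 1 choose Suc j) = (p - 1 - j) * (p - 1 choose j)"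
    by (simp only: binomial_absorption binomial_absorb_comp)
  then have "of_nat (Suc j) * of_nat (p - 1 choose Suc j)
      = of_nat (p - Suc j) * (of_nat (p - 1 choose j) :: rat)"
    by (metis diff_diff_left of_nat_mult plus_1_eq_Suc)
  then have ratio: "of_nat (p - 1 choose Suc j)
      = (of_nat p / of_nat (Suc j) - 1) * (of_nat (p - 1 choose j) :: rat)"
    using Suc.prems by (simp add: of_nat_diff field_simps)
  then have "(-1) ^ Suc j * of_nat (p - 1 choose Suc j)
      = (1 - of_nat p / of_nat (Suc j)) * ((-1) ^ j * of_nat (p - 1 choose j) :: rat)"
    unfolding ratio by (simp add: algebra_simps)
  also have "\<dots> = 1 - of_nat p * harmonic (Suc j)
      + (of_nat p)\<^sup>2 * (harmonic j / of_nat (Suc j) + z - of_nat p * z / of_nat (Suc j))"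
    unfolding z harmonic_Suc by (simp add: power2_eq_square algebra_simps add_divide_distrib diff_divide_distrib)
  finally show ?case
    using assms(1) Suc.prems z(1)
    by (intro bexI[of _ "harmonic j / of_nat (Suc j) + z - of_nat p * z / of_nat (Suc j)"])
      (auto intro!: Z_loc_closed Z_loc_of_nat simp del: of_nat_Suc)
qed

lemma binomial_prime_minus_1_mod:
  assumes "prime p" "j < p"
  shows "rat_cong ((-1) ^ j * of_nat (p - 1 choose j)) 1 p"
proof -
  obtain z where z: "z \<in> Z_loc p"
    "(-1) ^ j * of_nat (p - 1 choose j) = 1 - of_nat p * harmonic j + (of_nat p)\<^sup>2 * z"
    using binomial_prime_minus_1_mod_square [OF assms] by blast
  then show ?thesis
    using assms by (intro rat_congI[of _ _ _ "of_nat p * z - harmonic j"])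
      (auto intro!: Z_loc_closed Z_loc_of_nat simp: algebra_simps power2_eq_square)
qed

text \<open>
  A step from \<open>j\<close> to \<open>j + 1\<close> for these sums. The reason is
  \<open>(k - 1 choose Suc j) = (k - 1 choose j) * (k / Suc j - 1)\<close>: division by \<open>k\<close> leaves
  \<open>1 / Suc j\<close> times the sum of \<open>k - 1 choose j\<close>, which is \<open>n choose Suc j\<close>, minus the sum for \<open>j\<close>.
\<close>

lemma sum_binomial_over_index:
  "(\<Sum>k = 1..n. of_nat (k - 1 choose Suc j) / of_nat k)
     = of_nat (n choose Suc j) / of_nat (Suc j)
       - (\<Sum>k = 1..n. of_nat (k - 1 choose j) / of_nat k :: rat)"
proof (induction n)
  case (Suc n)
  have "Suc j * (Suc n choose Suc j) = Suc n * (n choose j)"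
    by (rule Suc_times_binomial)
  then have "of_nat (Suc j) * of_nat (Suc n choose Suc j) = of_nat (Suc n) * (of_nat (n choose j) :: rat)"
    by (metis of_nat_mult)
  then have "of_nat (Suc n choose Suc j) / of_nat (Suc n) = (of_nat (n choose j) :: rat) / of_nat (Suc j)"
    by (simp add: field_simps del: of_nat_Suc binomial_Suc_Suc)
  then have "of_nat (n choose Suc j) / of_nat (Suc n) + of_nat (n choose j) / of_nat (Suc n)
      = (of_nat (n choose j) :: rat) / of_nat (Suc j)"
    by (simp add: add_divide_distrib add.commute del: of_nat_Suc)
  with Suc show ?case
    by (simp add: add_divide_distrib del: of_nat_Suc)
qed simp

text \<open>
  For \<open>n = p - 1\<close> the boundary term of that step is \<open>\<plusminus>1 / Suc j\<close> modulo \<open>p\<close>, so after the sign is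
  taken out the sums obey the recurrence of the harmonic numbers; both start at \<open>0\<close> modulo \<open>p\<close>.
\<close>

lemma sum_binomial_over_index_prime:
  assumes "prime p" "p > 2" "j < p - 1"
  shows "rat_cong ((-1) ^ j * (\<Sum>k = 1..p - 1. of_nat (k - 1 choose j) / of_nat k)) (harmonic j) p"
  using \<open>j < p - 1\<close>
proof (induction j)
  case 0
  then show ?case using harmonic_prime_minus_1 [OF assms(1,2)] by (simp add: harmonic_eq_sum)
next
  case (Suc j)
  let ?S = "\<lambda>j. (\<Sum>k = 1..p - 1. of_nat (k - 1 choose j) / of_nat k) :: rat"
  have "(-1) ^ Suc j * ?S (Suc j)
      = (-1) ^ j * ?S j + 1 / of_nat (Suc j) * ((-1) ^ Suc j * of_nat (p - 1 choose Suc j))"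
    unfolding sum_binomial_over_index by (simp add: algebra_simps)
  moreover have "rat_cong (1 / of_nat (Suc j) * ((-1) ^ Suc j * of_nat (p - 1 choose Suc j)))
      (1 / of_nat (Suc j) * 1) p"
    using assms Suc.prems
    by (intro rat_cong_scale binomial_prime_minus_1_mod Z_loc_inverse_of_nat) auto
  ultimately show ?case
    using Suc by (auto simp only: harmonic_Suc mult_1_right intro: rat_cong_add)
qed

section \<open>The binomial transform\<close>

definition binomial_transform :: "(nat \<Rightarrow> 'a::comm_ring_1) \<Rightarrow> nat \<Rightarrow> 'a" where
  "binomial_transform w k = (\<Sum>j\<le>k. of_nat (k choose j) * (-1) ^ j * w j)"

lemma binomial_transform_0 [simp]: "binomial_transform w 0 = w 0"
  by (simp add: binomial_transform_def)

lemma binomial_transform_Suc: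
  "binomial_transform w (Suc k) = binomial_transform w k - binomial_transform (\<lambda>j. w (Suc j)) k"
proof -
  have "binomial_transform w (Suc k)
      = w 0 + (\<Sum>j\<le>k. of_nat (Suc k choose Suc j) * (-1) ^ Suc j * w (Suc j))"
    by (simp add: binomial_transform_def sum.atMost_Suc_shift del: sum.atMost_Suc binomial_Suc_Suc)
  also have "\<dots> = w 0 + (\<Sum>j\<le>k. of_nat (k choose Suc j) * (-1) ^ Suc j * w (Suc j))
      - binomial_transform (\<lambda>j. w (Suc j)) k"
    by (simp add: binomial_transform_def algebra_simps sum.distrib sum_negf sum_subtractf)
  also have "w 0 + (\<Sum>j\<le>k. of_nat (k choose Suc j) * (-1) ^ Suc j * w (Suc j))
      = (\<Sum>j\<le>Suc k. of_nat (k choose j) * (-1) ^ j * w j)"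
    by (simp add: sum.atMost_Suc_shift del: sum.atMost_Suc)
  also have "\<dots> = binomial_transform w k"
    by (simp add: binomial_transform_def binomial_eq_0)
  finally show ?thesis .
qed

text \<open>
  If \<open>x\<close> and \<open>1 - x\<close> are the roots of \<open>X\<^sup>2 - X + c\<close>, the transform exchanges their powers, so it
  preserves the recurrence which they satisfy. Comparison of two initial values then suffices to
  recognise an eigensequence.
\<close>

lemma binomial_transform_linear_recurrence:
  assumes rec: "\<And>n. w (Suc (Suc n)) = w (Suc n) - c * w n"
  shows "binomial_transform w (Suc (Suc k))
    = binomial_transform w (Suc k) - c * binomial_transform w k"
proof -
  let ?w1 = "\<lambda>j. w (Suc j)"
  have "binomial_transform (\<lambda>j. w (Suc (Suc j))) k
      = binomial_transform ?w1 k - c * binomial_transform w k"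
    unfolding binomial_transform_def rec
    by (simp add: sum_distrib_left sum_subtractf algebra_simps)
  then show ?thesis
    by (simp add: binomial_transform_Suc)
qed

lemma binomial_transform_eigen:
  assumes rec: "\<And>n. w (Suc (Suc n)) = w (Suc n) - c * w n"
    and "w 0 = e * w 0" "w 0 - w 1 = e * w 1"
  shows "binomial_transform w k = e * w k"
proof (induction k rule: induct_nat_012)
  case 0
  show ?case using assms(2) by simp
next
  case 1
  show ?case using assms(3) by (simp add: binomial_transform_Suc)
next
  case (ge2 k)
  then show ?case
    unfolding binomial_transform_linear_recurrence [of w c, OF rec] rec by (simp add: algebra_simps)
qed

section \<open>Harmonic sums of eigensequences\<close>

text \<open>
  Since \<open>(k choose j) / k\<^sup>2 = (k - 1 choose (j - 1)) / (k * j)\<close>, interchanging the summations leaves as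
  the coefficient of \<open>w j\<close>, for \<open>j > 0\<close>, a sign times \<open>1 / j\<close> times the sum of
  \<open>(k - 1 choose (j - 1)) / k\<close>, and this sum is \<open>\<plusminus>harmonic (j - 1)\<close> modulo \<open>p\<close>. The congruence then follows from \<open>harmonic (j - 1) = harmonic j - 1 / j\<close>.
\<close>

lemma sum_binomial_transform_over_square:
  assumes "prime p" "p > 2" and w: "\<And>k. w k \<in> Z_loc p"
  shows "rat_cong (\<Sum>k = 1..p - 1. binomial_transform w k / (of_nat k)\<^sup>2)
    (w 0 * (\<Sum>k = 1..p - 1. 1 / (of_nat k)\<^sup>2)
      + (\<Sum>j = 1..p - 1. w j / (of_nat j)\<^sup>2) - (\<Sum>j = 1..p - 1. w j * harmonic j / of_nat j)) p"
proof -
  let ?S = "\<lambda>j. (\<Sum>k = 1..p - 1. of_nat (k - 1 choose j) / of_nat k) :: rat"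
  have split: "binomial_transform w k
      = w 0 + (\<Sum>j = 1..p - 1. of_nat (k choose j) * (-1) ^ j * w j)" if "k < p" for k
  proof -
    have "binomial_transform w k = (\<Sum>j\<in>insert 0 {1..p - 1}. of_nat (k choose j) * (-1) ^ j * w j)"
      unfolding binomial_transform_def
      using that by (intro sum.mono_neutral_left) (auto simp: binomial_eq_0)
    then show ?thesis by simp
  qed
  have absorb: "of_nat (k choose j) / (of_nat k)\<^sup>2
      = of_nat (k - 1 choose (j - 1)) / of_nat k / (of_nat j :: rat)" if "0 < k" "0 < j" for k j
  proof -
    have "j * (k choose j) = k * (k - 1 choose (j - 1))"
      using that times_binomial_minus1_eq by blast
    then have "of_nat j * of_nat (k choose j) = of_nat k * (of_nat (k - 1 choose (j - 1)) :: rat)"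
      by (metis of_nat_mult)
    then show ?thesis using that by (simp add: field_simps power2_eq_square)
  qed
  have "(\<Sum>k = 1..p - 1. binomial_transform w k / (of_nat k)\<^sup>2)
      = (\<Sum>k = 1..p - 1. w 0 * (1 / (of_nat k)\<^sup>2)
          + (\<Sum>j = 1..p - 1. (-1) ^ j * w j * (of_nat (k choose j) / (of_nat k)\<^sup>2)))"
    using assms by (intro sum.cong refl, subst split)
      (auto simp: add_divide_distrib sum_divide_distrib mult_ac)
  also have "\<dots> = w 0 * (\<Sum>k = 1..p - 1. 1 / (of_nat k)\<^sup>2)
      + (\<Sum>j = 1..p - 1. \<Sum>k = 1..p - 1. (-1) ^ j * w j * (of_nat (k choose j) / (of_nat k)\<^sup>2))"
    by (subst sum.swap) (simp add: sum.distrib sum_distrib_left)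
  also have "(\<Sum>j = 1..p - 1. \<Sum>k = 1..p - 1. (-1) ^ j * w j * (of_nat (k choose j) / (of_nat k)\<^sup>2))
      = (\<Sum>j = 1..p - 1. - (w j / of_nat j) * ((-1) ^ (j - 1) * ?S (j - 1)))"
  proof (rule sum.cong [OF refl])
    fix j assume j: "j \<in> {1..p - 1}"
    then have sgn: "(-1) ^ j = - ((-1) ^ (j - 1) :: rat)" by (cases j) auto
    show "(\<Sum>k = 1..p - 1. (-1) ^ j * w j * (of_nat (k choose j) / (of_nat k)\<^sup>2))
      = - (w j / of_nat j) * ((-1) ^ (j - 1) * ?S (j - 1))"
      unfolding sum_distrib_left sgn
      using j by (intro sum.cong refl) (simp add: absorb mult_ac)
  qed
  finally have eq: "(\<Sum>k = 1..p - 1. binomial_transform w k / (of_nat k)\<^sup>2)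
      = w 0 * (\<Sum>k = 1..p - 1. 1 / (of_nat k)\<^sup>2)
        + (\<Sum>j = 1..p - 1. - (w j / of_nat j) * ((-1) ^ (j - 1) * ?S (j - 1)))" .
  have "rat_cong (\<Sum>j = 1..p - 1. - (w j / of_nat j) * ((-1) ^ (j - 1) * ?S (j - 1)))
      (\<Sum>j = 1..p - 1. - (w j / of_nat j) * harmonic (j - 1)) p"
    using assms
    by (intro rat_cong_sum rat_cong_scale sum_binomial_over_index_prime Z_loc_closed w) auto
  also have "(\<Sum>j = 1..p - 1. - (w j / of_nat j) * harmonic (j - 1))
      = (\<Sum>j = 1..p - 1. w j / (of_nat j)\<^sup>2) - (\<Sum>j = 1..p - 1. w j * harmonic j / of_nat j)"
    unfolding sum_subtractf [symmetric]
  proof (rule sum.cong [OF refl])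
    fix j assume "j \<in> {1..p - 1}"
    then have "harmonic j = harmonic (j - 1) + 1 / of_nat j"
      using harmonic_Suc [of "j - 1"] by simp
    then show "- (w j / of_nat j) * harmonic (j - 1)
        = w j / (of_nat j)\<^sup>2 - w j * harmonic j / of_nat j"
      by (simp add: algebra_simps power2_eq_square add_divide_distrib)
  qed
  finally show ?thesis
    unfolding eq by (auto simp: add_diff_eq [symmetric] intro: rat_cong_add rat_cong_refl)
qed

text \<open>
  The product of the harmonic number with itself is a sum over a square; the two triangles
  contribute equally and overlap in the diagonal.
\<close>

lemma sum_harmonic_over_index:
  "2 * (\<Sum>k = 1..n. harmonic k / of_nat k) = (harmonic n)\<^sup>2 + (\<Sum>k = 1..n. 1 / (of_nat k)\<^sup>2)"
  by (induction n)
    (simp_all add: harmonic_Suc power2_eq_square algebra_simps add_divide_distrib del: of_nat_Suc)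

text \<open>
  Write \<open>S\<close> for the sum. The constant sequence \<open>1\<close> has transform \<open>0\<close> at positive indices, so the
  expansion of transforms over squares gives \<open>2 * S \<equiv> (\<Sum>k. harmonic k / k)\<close>. The right side is also half of
  \<open>(harmonic (p - 1))\<^sup>2 + S \<equiv> S\<close>. Hence \<open>3 * S \<equiv> 0\<close>, and here \<open>p > 3\<close> enters.
\<close>

lemma sum_inverse_squares_prime:
  assumes "prime p" "p > 3"
  shows "rat_cong (\<Sum>k = 1..p - 1. 1 / (of_nat k)\<^sup>2) 0 p"
proof -
  let ?S2 = "\<Sum>k = 1..p - 1. 1 / (of_nat k)\<^sup>2 :: rat"
  let ?F = "\<Sum>k = 1..p - 1. harmonic k / of_nat k"
  have "binomial_transform (\<lambda>_. 1 :: rat) k = 0" if "k > 0" for k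
    using that by (cases k) (simp_all add: binomial_transform_Suc)
  then have "rat_cong 0 (2 * ?S2 - ?F) p"
    using sum_binomial_transform_over_square [of p "\<lambda>_. 1"] assms by simp
  then obtain y where y: "y \<in> Z_loc p" "0 = 2 * ?S2 - ?F + of_nat p * y"
    by (metis rat_congE)
  obtain h where h: "h \<in> Z_loc p" "harmonic (p - 1) = of_nat p * h"
    using harmonic_prime_minus_1 [of p] assms by (auto elim: rat_congE)
  have "2 * ?F = of_nat p * (of_nat p * h\<^sup>2) + ?S2"
    using sum_harmonic_over_index [of "p - 1"] h by (simp add: power2_eq_square mult_ac)
  then have S2: "?S2 - 0 = of_nat p * ((of_nat p * h\<^sup>2 - of_nat 2 * y) / of_nat 3)"
    using y(2) by (simp add: algebra_simps)
  show ?thesis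
    by (rule rat_congI [OF S2]) (use assms y(1) h(1) in \<open>intro Z_loc_closed Z_loc_of_nat; simp\<close>)
qed

lemma harmonic_sum_of_eigensequence:
  assumes "prime p" "p > 3" and w: "\<And>k. w k \<in> Z_loc p"
    and eigen: "\<And>k. binomial_transform w k = e * w k"
  shows "rat_cong (\<Sum>k = 1..p - 1. w k * harmonic k / of_nat k)
    ((1 - e) * (\<Sum>k = 1..p - 1. w k / (of_nat k)\<^sup>2)) p"
proof -
  define F G S where "F = (\<Sum>k = 1..p - 1. w k * harmonic k / of_nat k)"
    and "G = (\<Sum>k = 1..p - 1. w k / (of_nat k)\<^sup>2)"
    and "S = (\<Sum>k = 1..p - 1. 1 / (of_nat k)\<^sup>2 :: rat)"
  have "rat_cong (e * G) (w 0 * S + G - F) p"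
    using sum_binomial_transform_over_square [of p w] assms
    by (simp add: F_def G_def S_def sum_distrib_left)
  then have "rat_cong (w 0 * S + G - e * G) (w 0 * S + G - (w 0 * S + G - F)) p"
    by (intro rat_cong_diff rat_cong_refl)
  also have "w 0 * S + G - (w 0 * S + G - F) = F" by simp
  finally have "rat_cong (w 0 * S + G - e * G) F p" .
  moreover have "rat_cong (w 0 * S + (G - e * G)) (w 0 * 0 + (G - e * G)) p"
    unfolding S_def using assms
    by (intro rat_cong_add rat_cong_refl rat_cong_scale sum_inverse_squares_prime)
  ultimately have "rat_cong F (G - e * G) p"
    by (simp add: add_diff_eq) (blast intro: rat_cong_sym rat_cong_trans)
  then show ?thesis
    by (simp add: F_def G_def algebra_simps)
qed

text \<open>
  As \<open>w 0 = 0\<close> and \<open>p\<close> is odd, the two outer terms of the transform at \<open>p\<close> are \<open>0\<close> and \<open>- w p\<close>. The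
  latter equals the transform itself, so the terms with \<open>0 < k < p\<close> sum to zero. Each of them
  contains \<open>(p choose k) = p / k * (p - 1 choose (k - 1))\<close>; after cancelling \<open>p\<close>, the last binomial
  coefficient is needed modulo \<open>p\<^sup>2\<close>, because the sum of \<open>w k / k\<close> is divided by \<open>p\<close> once more.
\<close>

lemma odd_eigensequence_mod_square:
  assumes "prime p" "p > 2" and w: "\<And>k. w k \<in> Z_loc p"
    and eigen: "\<And>k. binomial_transform w k = - w k"
  shows "rat_cong (1 / of_nat p * (\<Sum>k = 1..p - 1. w k / of_nat k))
    ((\<Sum>k = 1..p - 1. w k * harmonic k / of_nat k) - (\<Sum>k = 1..p - 1. w k / (of_nat k)\<^sup>2)) p"
proof -
  have "\<forall>j\<in>{..<p}. \<exists>z. z \<in> Z_loc p \<and> (-1) ^ j * of_nat (p - 1 choose j)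
           = 1 - of_nat p * harmonic j + (of_nat p)\<^sup>2 * (z :: rat)"
    using binomial_prime_minus_1_mod_square assms(1) by blast
  then obtain z where z: "\<And>j. j < p \<Longrightarrow> z j \<in> Z_loc p"
    "\<And>j. j < p \<Longrightarrow> (-1) ^ j * of_nat (p - 1 choose j)
           = 1 - of_nat p * harmonic j + (of_nat p)\<^sup>2 * z j"
    by (metis lessThan_iff)
  have w0: "w 0 = 0"
    using eigen [of 0] by simp
  have "odd p" using assms prime_odd_nat by auto
  have range: "{..p} = insert 0 (insert p {1..p - 1})" using assms by auto
  have "binomial_transform w p = (\<Sum>k = 1..p - 1. of_nat (p choose k) * (-1) ^ k * w k) - w p"
    using \<open>odd p\<close> assms(2) w0 unfolding binomial_transform_def range by simp
  then have "0 = (\<Sum>k = 1..p - 1. of_nat (p choose k) * (-1) ^ k * w k)"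
    using eigen [of p] by simp
  also have "\<dots> = (\<Sum>k = 1..p - 1. - of_nat p * (w k / of_nat k
      - of_nat p * (w k * harmonic k / of_nat k - w k / (of_nat k)\<^sup>2)
      + of_nat p * (of_nat p * (w k * z (k - 1) / of_nat k))))"
  proof (rule sum.cong [OF refl])
    fix k assume k: "k \<in> {1..p - 1}"
    then have "k * (p choose k) = p * (p - 1 choose (k - 1))"
      using times_binomial_minus1_eq by simp
    then have "of_nat k * of_nat (p choose k) = of_nat p * (of_nat (p - 1 choose (k - 1)) :: rat)"
      by (metis of_nat_mult)
    then have b: "of_nat (p choose k) = of_nat p / of_nat k * (of_nat (p - 1 choose (k - 1)) :: rat)"
      using k by (simp add: field_simps)
    have sgn: "(-1) ^ k = - ((-1) ^ (k - 1) :: rat)" using k by (cases k) auto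
    have "harmonic (k - 1) = harmonic k - 1 / of_nat k"
      using k harmonic_Suc [of "k - 1"] by simp
    then have a: "(-1) ^ (k - 1) * of_nat (p - 1 choose (k - 1))
        = 1 - of_nat p * (harmonic k - 1 / of_nat k) + (of_nat p)\<^sup>2 * z (k - 1)"
      using z(2) [of "k - 1"] k assms(2) by auto
    have "of_nat (p choose k) * (-1) ^ k * w k
        = - of_nat p * (w k / of_nat k * ((-1) ^ (k - 1) * of_nat (p - 1 choose (k - 1))))"
      unfolding b sgn by simp
    then show "of_nat (p choose k) * (-1) ^ k * w k = - of_nat p * (w k / of_nat k
      - of_nat p * (w k * harmonic k / of_nat k - w k / (of_nat k)\<^sup>2)
      + of_nat p * (of_nat p * (w k * z (k - 1) / of_nat k)))"
      unfolding a
      by (simp add: algebra_simps power2_eq_square add_divide_distrib diff_divide_distrib)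
  qed
  also have "\<dots> = - of_nat p * ((\<Sum>k = 1..p - 1. w k / of_nat k)
      - of_nat p * ((\<Sum>k = 1..p - 1. w k * harmonic k / of_nat k) - (\<Sum>k = 1..p - 1. w k / (of_nat k)\<^sup>2))
      + of_nat p * (of_nat p * (\<Sum>k = 1..p - 1. w k * z (k - 1) / of_nat k)))"
    by (simp only: sum_distrib_left [symmetric] sum.distrib sum_subtractf)
  finally have "(\<Sum>k = 1..p - 1. w k / of_nat k)
      - of_nat p * ((\<Sum>k = 1..p - 1. w k * harmonic k / of_nat k) - (\<Sum>k = 1..p - 1. w k / (of_nat k)\<^sup>2))
      + of_nat p * (of_nat p * (\<Sum>k = 1..p - 1. w k * z (k - 1) / of_nat k)) = 0"
    using assms(2) by (metis (no_types, lifting) mult_eq_0_iff neg_equal_0_iff_equal not_less_zero of_nat_eq_0_iff)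
  then have "1 / of_nat p * (\<Sum>k = 1..p - 1. w k / of_nat k)
      - ((\<Sum>k = 1..p - 1. w k * harmonic k / of_nat k) - (\<Sum>k = 1..p - 1. w k / (of_nat k)\<^sup>2))
      = of_nat p * - (\<Sum>k = 1..p - 1. w k * z (k - 1) / of_nat k)"
    using assms(2) by (simp add: field_simps)
  then show ?thesis
    by (rule rat_congI) (use assms z in \<open>auto intro!: Z_loc_closed w\<close>)
qed

section \<open>Lucas sequences as eigensequences\<close>

theorem theorem1p1:
  fixes p :: nat and A B :: int
  assumes "prime p" and "p > 3" and "\<not> int p dvd A"
  shows "rat_cong
           (\<Sum>k = 1..p - 1. of_int (lucas_v A B k) * harmonic k / (of_nat k * of_int A ^ k))
           0 p \<and>
         rat_cong
           (\<Sum>k = 1..p - 1. of_int (lucas_u A B k) * harmonic k / (of_nat k * of_int A ^ k))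
           (2 / of_nat p * (\<Sum>k = 1..p - 1. of_int (lucas_u A B k) / (of_nat k * of_int A ^ k)))
           p"
proof -
  define u v :: "nat \<Rightarrow> rat" where "u k = of_int (lucas_u A B k) / of_int A ^ k"
    and "v k = of_int (lucas_v A B k) / of_int A ^ k" for k
  have A: "A \<noteq> 0" using assms by auto
  have integral: "of_int a / of_int A ^ k \<in> Z_loc p" for a :: int and k
    using Z_loc_mult [OF Z_loc_of_int [of a]
        Z_loc_power [OF Z_loc_inverse_of_int [OF assms(1,3)], of k]]
    by (simp add: power_one_over)
  have u: "u k \<in> Z_loc p" and v: "v k \<in> Z_loc p" for k
    unfolding u_def v_def by (rule integral)+
  have rec_u: "u (Suc (Suc n)) = u (Suc n) - of_int B / (of_int A)\<^sup>2 * u n"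
    and rec_v: "v (Suc (Suc n)) = v (Suc n) - of_int B / (of_int A)\<^sup>2 * v n" for n
    using A by (simp_all add: u_def v_def field_simps power2_eq_square)
  have eigen_v: "binomial_transform v k = 1 * v k" for k
    by (rule binomial_transform_eigen [where w = v, OF rec_v]) (use A in \<open>simp_all add: v_def\<close>)
  have eigen_u: "binomial_transform u k = - 1 * u k" for k
    by (rule binomial_transform_eigen [where w = u, OF rec_u]) (use A in \<open>simp_all add: u_def\<close>)
  have V: "rat_cong (\<Sum>k = 1..p - 1. v k * harmonic k / of_nat k) 0 p"
    using harmonic_sum_of_eigensequence [OF assms(1,2) v eigen_v] by simp
  define F G G2 where "F = (\<Sum>k = 1..p - 1. u k * harmonic k / of_nat k)"
    and "G = 1 / of_nat p * (\<Sum>k = 1..p - 1. u k / of_nat k)"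
    and "G2 = (\<Sum>k = 1..p - 1. u k / (of_nat k)\<^sup>2)"
  have F: "rat_cong F (2 * G2) p"
    using harmonic_sum_of_eigensequence [OF assms(1,2) u eigen_u] by (simp add: F_def G2_def)
  have "rat_cong G (F - G2) p"
    using odd_eigensequence_mod_square [OF assms(1) _ u] eigen_u assms(2)
    by (simp add: F_def G_def G2_def)
  then have "rat_cong (of_nat 2 * G) (of_nat 2 * (F - G2)) p"
    by (intro rat_cong_scale Z_loc_of_nat)
  then have G: "rat_cong (2 * G) (2 * F - 2 * G2) p"
    by (simp add: algebra_simps)
  have "rat_cong (2 * F - F) (2 * F - 2 * G2) p"
    using F by (intro rat_cong_diff rat_cong_refl)
  with G have "rat_cong F (2 * G) p"
    by simp (blast intro: rat_cong_sym rat_cong_trans)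
  with V show ?thesis
    by (simp add: F_def G_def u_def v_def mult_ac)
qed

end
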